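(* Let $p$ be a prime, $n\geq 3$ and $A\in M_2(\mathbb{F}_p)$. Suppose $A\neq c\cdot I$ for every $c\in\mathbb{F}_p$, and let $R=\{B\in M_2(\mathbb{F}_p)\mid B^n=A\}$ be the set of $n$-th roots of $A$. Then $$R\subset\left\{B\in M_2(\mathbb{F}_p)\ \middle|\ B=\frac{A+b\,Q_{n-2}(a,b)\cdot I}{Q_{n-1}(a,b)},\ b^n=\det A,\ P_n(a,b)=\operatorname{tr}A\right\},$$ i.e. for every $B\in R$ there are $a,b\in\mathbb{F}_p$ with $b^n=\det A$, $P_n(a,b)=\operatorname{tr}A$, $Q_{n-1}(a,b)\neq0$ and $B=\frac{A+b\,Q_{n-2}(a,b)I}{Q_{n-1}(a,b)}$.
   Context: $I$ is the $2\times2$ identity matrix. For $m\ge 0$ let $h_m(x,y)=\sum_{k=0}^m x^ky^{m-k}$ be the complete symmetric polynomial of degree $m$ in two variables and let $p_m(x,y)=x^m+y^m$ be the power sum. $Q_m,P_m\in\mathbb{F}_p[x,y]$ are the unique polynomials such that $Q_m(x+y,xy)=h_m(x,y)$ and $P_m(x+y,xy)=p_m(x,y)$. *)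

theory Defs
  imports
    "Berlekamp_Zassenhaus.Finite_Field"
    "Jordan_Normal_Form.Matrix"
    "Jordan_Normal_Form.Determinant"
begin

text \<open>
  The field with p elements is the type \<open>'p mod_ring\<close> with \<open>'p :: prime_card\<close>, where
  p is the cardinality of \<open>'p\<close>.  A polynomial ring in two variables over R is \<open>R poly poly\<close>:
  the first variable belongs to the inner, the second one to the outer polynomial layer.
\<close>

definition subst2 :: "('a \<Rightarrow> 'b) \<Rightarrow> 'a::zero poly poly \<Rightarrow> 'b \<Rightarrow> 'b \<Rightarrow> 'b::comm_semiring_1" where
  "subst2 h f u v = eval_poly (\<lambda>c. eval_poly h c u) f v"

definition poly2 :: "'a::comm_semiring_1 poly poly \<Rightarrow> 'a \<Rightarrow> 'a \<Rightarrow> 'a" where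
  "poly2 f a b = subst2 (\<lambda>c. c) f a b"

definition const2 :: "'a::zero \<Rightarrow> 'a poly poly" where
  "const2 c = [:[:c:]:]"

definition varX :: "'a::comm_semiring_1 poly poly" where
  "varX = [:[:0, 1:]:]"

definition varY :: "'a::comm_semiring_1 poly poly" where
  "varY = [:0, 1:]"

definition complete_sym :: "nat \<Rightarrow> 'a::comm_semiring_1 \<Rightarrow> 'a \<Rightarrow> 'a" where
  "complete_sym m x y = (\<Sum>k\<le>m. x ^ k * y ^ (m - k))"

definition power_sum :: "nat \<Rightarrow> 'a::comm_semiring_1 \<Rightarrow> 'a \<Rightarrow> 'a" where
  "power_sum m x y = x ^ m + y ^ m"

text \<open>
  The descriptions below are proper by \<open>ex1_Qpoly\<close> and \<open>ex1_Ppoly\<close>.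
\<close>

definition Qpoly :: "nat \<Rightarrow> 'a::idom poly poly" where
  "Qpoly m = (THE f. subst2 const2 f (varX + varY) (varX * varY) = complete_sym m varX varY)"

definition Ppoly :: "nat \<Rightarrow> 'a::idom poly poly" where
  "Ppoly m = (THE f. subst2 const2 f (varX + varY) (varX * varY) = power_sum m varX varY)"

definition mat_trace :: "'a::comm_monoid_add mat \<Rightarrow> 'a" where
  "mat_trace A = (\<Sum>i<dim_row A. A $$ (i, i))"

lemma comm_ring_hom_eval_poly:
  fixes h :: "'a::comm_ring_1 \<Rightarrow> 'b::comm_ring_1"
  assumes "comm_ring_hom h"
  shows "comm_ring_hom (\<lambda>p. eval_poly h p u)"
proof -
  interpret h: comm_ring_hom h by fact
  interpret m: map_poly_comm_ring_hom h ..
  show ?thesis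
    by unfold_locales (simp_all add: eval_poly_def m.hom_add m.hom_mult)
qed

lemma comm_ring_hom_subst2:
  fixes h :: "'a::comm_ring_1 \<Rightarrow> 'b::comm_ring_1"
  assumes "comm_ring_hom h"
  shows "comm_ring_hom (\<lambda>f. subst2 h f u v)"
  unfolding subst2_def by (intro comm_ring_hom_eval_poly assms)

lemma comm_ring_hom_const2: "comm_ring_hom (const2 :: 'a::comm_ring_1 \<Rightarrow> _)"
  by unfold_locales (simp_all add: const2_def one_pCons)

lemma comm_ring_hom_id: "comm_ring_hom (\<lambda>c :: 'a::comm_ring_1. c)"
  by unfold_locales simp_all

lemma eval_poly_pCons:
  fixes h :: "'a::comm_ring_1 \<Rightarrow> 'b::comm_ring_1"
  assumes "comm_ring_hom h"
  shows "eval_poly h (pCons a p) u = h a + u * eval_poly h p u"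
proof -
  interpret h: comm_ring_hom h by fact
  show ?thesis by (simp add: eval_poly_def h.map_poly_pCons_hom)
qed

lemma subst2_pCons:
  fixes h :: "'a::comm_ring_1 \<Rightarrow> 'b::comm_ring_1"
  assumes "comm_ring_hom h"
  shows "subst2 h (pCons c f) u v = eval_poly h c u + v * subst2 h f u v"
  unfolding subst2_def by (rule eval_poly_pCons[OF comm_ring_hom_eval_poly[OF assms]])

lemma subst2_vars:
  fixes h :: "'a::comm_ring_1 \<Rightarrow> 'b::comm_ring_1"
  assumes "comm_ring_hom h"
  shows "subst2 h varX u v = u" "subst2 h varY u v = v"
proof -
  interpret h: comm_ring_hom h by fact
  have z: "subst2 h 0 u v = 0" "eval_poly h 0 u = 0" by (simp_all add: subst2_def eval_poly_def)
  show "subst2 h varX u v = u" "subst2 h varY u v = v"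
    unfolding varX_def varY_def
    by (simp_all add: subst2_pCons[OF assms] eval_poly_pCons[OF assms] z one_pCons)
qed

lemma poly_0_eval_sum_vars:
  fixes c :: "'a::comm_ring_1 poly"
  shows "poly (eval_poly const2 c (varX + varY)) 0 = c"
proof (induction c)
  case 0
  show ?case by (simp add: eval_poly_def)
next
  case (pCons a c)
  then show ?case
    unfolding eval_poly_pCons[OF comm_ring_hom_const2] poly_add poly_mult pCons.IH
    by (simp add: const2_def varX_def varY_def)
qed

lemma subst2_elementary_inject:
  fixes f g :: "'a::idom poly poly"
  assumes "subst2 const2 f (varX + varY) (varX * varY) = subst2 const2 g (varX + varY) (varX * varY)"
  shows "f = g"
  using assms
proof (induction f g rule: poly_induct2)
  case 0
  show ?case by simp
next
  case (pCons c f d g)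
  let ?E = "\<lambda>f. subst2 const2 f (varX + varY) (varX * varY) :: 'a poly poly"
  let ?e = "\<lambda>c. eval_poly const2 c (varX + varY) :: 'a poly poly"
  have eq: "?e c + (varX * varY) * ?E f = ?e d + (varX * varY) * ?E g"
    using pCons.prems by (simp add: subst2_pCons[OF comm_ring_hom_const2])
  have "poly (varY :: 'a poly poly) 0 = 0" by (simp add: varY_def)
  with arg_cong[OF eq, of "\<lambda>q. poly q 0"] have cd: "c = d"
    by (simp add: poly_0_eval_sum_vars)
  have "varX * varY \<noteq> (0 :: 'a poly poly)" by (simp add: varX_def varY_def)
  with eq cd have "?E f = ?E g" by simp
  with pCons.IH cd show ?case by simp
qed

lemma complete_sym_Suc:
  "complete_sym (Suc m) x y = x ^ Suc m + y * complete_sym m x y"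
proof -
  have "(\<Sum>k\<le>m. x ^ k * y ^ (Suc m - k)) = y * (\<Sum>k\<le>m. x ^ k * y ^ (m - k))"
    unfolding sum_distrib_left by (rule sum.cong) (simp_all add: Suc_diff_le mult_ac)
  then show ?thesis by (simp add: complete_sym_def add.commute)
qed

lemma complete_sym_rec:
  fixes x y :: "'a::comm_ring_1"
  shows "complete_sym (Suc (Suc m)) x y =
    (x + y) * complete_sym (Suc m) x y - x * y * complete_sym m x y"
  by (simp add: complete_sym_Suc algebra_simps)

lemma power_sum_rec:
  fixes x y :: "'a::comm_ring_1"
  shows "power_sum (Suc (Suc m)) x y =
    (x + y) * power_sum (Suc m) x y - x * y * power_sum m x y"
  by (simp add: power_sum_def algebra_simps)

lemma ex_subst2_elementary:
  fixes s :: "nat \<Rightarrow> 'a::idom poly poly"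
  assumes "\<And>m. s (Suc (Suc m)) = (varX + varY) * s (Suc m) - varX * varY * s m"
    and "subst2 const2 f0 (varX + varY) (varX * varY) = s 0"
    and "subst2 const2 f1 (varX + varY) (varX * varY) = s 1"
  shows "\<exists>f. subst2 const2 f (varX + varY) (varX * varY) = s m"
proof -
  let ?E = "\<lambda>f. subst2 const2 f (varX + varY) (varX * varY) :: 'a poly poly"
  interpret E: comm_ring_hom ?E by (rule comm_ring_hom_subst2[OF comm_ring_hom_const2])
  have "(\<exists>f. ?E f = s m) \<and> (\<exists>f. ?E f = s (Suc m))"
  proof (induction m)
    case 0
    show ?case using assms(2,3) by auto
  next
    case (Suc m)
    then obtain f g where fg: "?E f = s m" "?E g = s (Suc m)" by blast
    have "?E (varX * g - varY * f) = s (Suc (Suc m))"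
      by (simp add: E.hom_minus E.hom_mult subst2_vars[OF comm_ring_hom_const2] fg assms(1))
    with Suc show ?case by blast
  qed
  then show ?thesis by blast
qed

lemma ex1_Qpoly:
  "\<exists>!f :: 'a::idom poly poly.
    subst2 const2 f (varX + varY) (varX * varY) = complete_sym m varX varY"
proof (rule ex_ex1I)
  interpret E: comm_ring_hom "\<lambda>f. subst2 const2 f (varX + varY) (varX * varY) :: 'a poly poly"
    by (rule comm_ring_hom_subst2[OF comm_ring_hom_const2])
  show "\<exists>f :: 'a poly poly.
      subst2 const2 f (varX + varY) (varX * varY) = complete_sym m varX varY"
    by (rule ex_subst2_elementary[where ?f0.0 = 1 and ?f1.0 = varX])
      (simp_all only: complete_sym_rec subst2_vars[OF comm_ring_hom_const2] E.hom_one,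
       simp_all add: complete_sym_def)
qed (rule subst2_elementary_inject, simp)

lemma ex1_Ppoly:
  "\<exists>!f :: 'a::idom poly poly.
    subst2 const2 f (varX + varY) (varX * varY) = power_sum m varX varY"
proof (rule ex_ex1I)
  interpret E: comm_ring_hom "\<lambda>f. subst2 const2 f (varX + varY) (varX * varY) :: 'a poly poly"
    by (rule comm_ring_hom_subst2[OF comm_ring_hom_const2])
  show "\<exists>f :: 'a poly poly.
      subst2 const2 f (varX + varY) (varX * varY) = power_sum m varX varY"
    by (rule ex_subst2_elementary[where ?f0.0 = "1 + 1" and ?f1.0 = varX])
      (simp_all only: power_sum_rec subst2_vars[OF comm_ring_hom_const2] E.hom_one E.hom_add,
       simp_all add: power_sum_def)
qed (rule subst2_elementary_inject, simp)

lemma subst2_Qpoly: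
  "subst2 const2 (Qpoly m :: 'a::idom poly poly) (varX + varY) (varX * varY) =
    complete_sym m varX varY"
  unfolding Qpoly_def by (rule theI'[OF ex1_Qpoly])

lemma subst2_Ppoly:
  "subst2 const2 (Ppoly m :: 'a::idom poly poly) (varX + varY) (varX * varY) =
    power_sum m varX varY"
  unfolding Ppoly_def by (rule theI'[OF ex1_Ppoly])

end

theory Submission
  imports Defs
begin

text \<open>
  Put \<open>a = tr B\<close> and \<open>b = det B\<close>. The Cayley--Hamilton relation \<open>B\<^sup>2 = a B - b I\<close> makes the powers
  of \<open>B\<close> satisfy the linear recurrence with characteristic polynomial \<open>T\<^sup>2 - a T + b\<close>, which is also
  the recurrence of \<open>Q\<^sub>m(a, b)\<close> and \<open>P\<^sub>m(a, b)\<close>. Hence \<open>B\<^sup>n = Q\<^bsub>n-1\<^esub>(a, b) B - b Q\<^bsub>n-2\<^esub>(a, b) I\<close>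
  and \<open>tr B\<^sup>n = P\<^sub>n(a, b)\<close>. As \<open>A = B\<^sup>n\<close> is not scalar, the coefficient of \<open>B\<close> is nonzero, so the
  first equation can be solved for \<open>B\<close>.
\<close>

text \<open>Substituting the elementary symmetric polynomials is injective, so an identity for
  \<open>Qpoly\<close> need only be checked after the substitution, among polynomials in x and
  y.\<close>

lemma Qpoly_eqI:
  "subst2 const2 f (varX + varY) (varX * varY) = complete_sym m varX varY \<Longrightarrow>
    Qpoly m = (f :: 'a::idom poly poly)"
  by (rule subst2_elementary_inject) (simp add: subst2_Qpoly)

lemma Ppoly_eqI:
  "subst2 const2 f (varX + varY) (varX * varY) = power_sum m varX varY \<Longrightarrow>
    Ppoly m = (f :: 'a::idom poly poly)"
  by (rule subst2_elementary_inject) (simp add: subst2_Ppoly)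

context
begin

interpretation E: comm_ring_hom
  "\<lambda>f. subst2 const2 f (varX + varY) (varX * varY) :: 'a::idom poly poly"
  by (rule comm_ring_hom_subst2[OF comm_ring_hom_const2])

lemma Qpoly_0: "Qpoly 0 = (1 :: 'a::idom poly poly)"
  by (rule Qpoly_eqI) (simp add: complete_sym_def E.hom_one)

lemma Qpoly_1: "Qpoly (Suc 0) = (varX :: 'a::idom poly poly)"
  by (rule Qpoly_eqI) (simp add: complete_sym_def subst2_vars[OF comm_ring_hom_const2])

text \<open>The substitution sends \<open>varX\<close> to x + y and \<open>varY\<close> to x y, so
  the claim becomes the two-step recurrence of h_m.\<close>

lemma Qpoly_rec:
  "Qpoly (Suc (Suc m)) = varX * Qpoly (Suc m) - varY * (Qpoly m :: 'a::idom poly poly)"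
  by (rule Qpoly_eqI)
    (simp add: complete_sym_rec E.hom_minus E.hom_mult subst2_Qpoly
      subst2_vars[OF comm_ring_hom_const2])

text \<open>The value 2 is kept as \<open>1 + 1\<close>, to which the homomorphism laws for sums and
  1 apply directly.\<close>

lemma Ppoly_0: "Ppoly 0 = (1 + 1 :: 'a::idom poly poly)"
  by (rule Ppoly_eqI) (simp only: power_sum_def E.hom_one E.hom_add power_0)

lemma Ppoly_1: "Ppoly (Suc 0) = (varX :: 'a::idom poly poly)"
  by (rule Ppoly_eqI) (simp add: power_sum_def subst2_vars[OF comm_ring_hom_const2])

lemma Ppoly_rec:
  "Ppoly (Suc (Suc m)) = varX * Ppoly (Suc m) - varY * (Ppoly m :: 'a::idom poly poly)"
  by (rule Ppoly_eqI)
    (simp add: power_sum_rec E.hom_minus E.hom_mult subst2_Ppoly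
      subst2_vars[OF comm_ring_hom_const2])

end

context
  fixes a b :: "'a::idom"
begin

interpretation E: comm_ring_hom "\<lambda>f. poly2 f a b"
  unfolding poly2_def by (rule comm_ring_hom_subst2[OF comm_ring_hom_id])

lemma poly2_vars: "poly2 varX a b = a" "poly2 varY a b = b"
  by (simp_all add: poly2_def subst2_vars[OF comm_ring_hom_id])

text \<open>Evaluation at (a, b) is a ring homomorphism, so it carries the recurrence over to
  values. Thus a and b need not be split into eigenvalues, which may lie outside the field.\<close>

lemma poly2_Qpoly:
  "poly2 (Qpoly 0) a b = 1"
  "poly2 (Qpoly (Suc 0)) a b = a"
  "poly2 (Qpoly (Suc (Suc m))) a b = a * poly2 (Qpoly (Suc m)) a b - b * poly2 (Qpoly m) a b"
  by (simp_all only: Qpoly_0 Qpoly_1 Qpoly_rec E.hom_one E.hom_minus E.hom_mult poly2_vars)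

lemma poly2_Ppoly:
  "poly2 (Ppoly 0) a b = 1 + 1"
  "poly2 (Ppoly (Suc 0)) a b = a"
  "poly2 (Ppoly (Suc (Suc m))) a b = a * poly2 (Ppoly (Suc m)) a b - b * poly2 (Ppoly m) a b"
  by (simp_all only: Ppoly_0 Ppoly_1 Ppoly_rec E.hom_one E.hom_add E.hom_minus E.hom_mult
      poly2_vars)

end

lemma mat_2_eqI:
  assumes "M \<in> carrier_mat 2 2" "N \<in> carrier_mat 2 2"
    and "M $$ (0, 0) = N $$ (0, 0)" "M $$ (0, 1) = N $$ (0, 1)"
    and "M $$ (1, 0) = N $$ (1, 0)" "M $$ (1, 1) = N $$ (1, 1)"
  shows "M = N"
  using assms by (intro eq_matI) (auto simp: less_2_cases_iff)

lemma mult_mat_2_index: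
  assumes "M \<in> carrier_mat 2 2" "N \<in> carrier_mat 2 2" "i < 2" "j < 2"
  shows "(M * N) $$ (i, j) = M $$ (i, 0) * N $$ (0, j) + M $$ (i, 1) * N $$ (1, j)"
  using assms by (simp add: scalar_prod_def numeral_2_eq_2)

lemma mat_trace_smult_minus_smult:
  fixes M N :: "'a::comm_ring_1 mat"
  assumes "M \<in> carrier_mat k k" "N \<in> carrier_mat k k"
  shows "mat_trace (c \<cdot>\<^sub>m M - d \<cdot>\<^sub>m N) = c * mat_trace M - d * mat_trace N"
  using assms by (simp add: mat_trace_def sum_subtractf sum_distrib_left)

lemma mat_trace_2:
  "M \<in> carrier_mat 2 2 \<Longrightarrow> mat_trace M = M $$ (0, 0) + M $$ (1, 1)"
  by (auto simp: mat_trace_def numeral_2_eq_2)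

lemma det_mat_2:
  fixes M :: "'a::comm_ring_1 mat"
  assumes "M \<in> carrier_mat 2 2"
  shows "det M = M $$ (0, 0) * M $$ (1, 1) - M $$ (0, 1) * M $$ (1, 0)"
proof -
  \<comment> \<open>Deleting row i and column 0 leaves a single entry, from the other row
    \<open>1 - i\<close>.\<close>
  have "det (mat_delete M i 0) = M $$ (1 - i, 1)" if "i < 2" for i
  proof -
    have "mat_delete M i 0 \<in> carrier_mat 1 1"
      using assms by (auto simp: mat_delete_def)
    then have "det (mat_delete M i 0) = mat_delete M i 0 $$ (0, 0)"
      by (rule det_single)
    also have "\<dots> = M $$ (1 - i, 1)"
      using assms that by (auto simp: mat_delete_def less_2_cases_iff)
    finally show ?thesis .
  qed
  then show ?thesis
    by (simp add: laplace_expansion_column[OF assms, of 0] cofactor_def numeral_2_eq_2)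
qed

lemma det_pow_mat:
  fixes B :: "'a::comm_ring_1 mat"
  assumes "B \<in> carrier_mat k k"
  shows "det (B ^\<^sub>m n) = det B ^ n"
  using assms
  by (induction n) (simp_all add: det_mult[OF pow_carrier_mat] mult.commute)

context
  fixes B :: "'a::idom mat"
  assumes B: "B \<in> carrier_mat 2 2"
begin

lemma cayley_hamilton_2: "B * B = mat_trace B \<cdot>\<^sub>m B - det B \<cdot>\<^sub>m 1\<^sub>m 2"
  by (rule mat_2_eqI)
    (use B in \<open>auto simp: mult_mat_2_index mat_trace_2 det_mat_2 algebra_simps
      simp del: index_mult_mat(1)\<close>)

text \<open>Shifting the exponent by two avoids truncated subtraction in the indices. The base case
  is Cayley-Hamilton, as Q_1 = a and Q_0 = 1.\<close>

lemma pow_mat_2_Qpoly: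
  "B ^\<^sub>m Suc (Suc m) =
    poly2 (Qpoly (Suc m)) (mat_trace B) (det B) \<cdot>\<^sub>m B
      - (det B * poly2 (Qpoly m) (mat_trace B) (det B)) \<cdot>\<^sub>m 1\<^sub>m 2"
proof (induction m)
  case 0
  show ?case using B cayley_hamilton_2 by (simp add: poly2_Qpoly)
next
  case (Suc m)
  let ?q = "\<lambda>m. poly2 (Qpoly m) (mat_trace B) (det B)"
  have "B ^\<^sub>m Suc (Suc (Suc m)) = (?q (Suc m) \<cdot>\<^sub>m B - (det B * ?q m) \<cdot>\<^sub>m 1\<^sub>m 2) * B"
    using Suc.IH by simp
  also have "\<dots> = ?q (Suc m) \<cdot>\<^sub>m (B * B) - (det B * ?q m) \<cdot>\<^sub>m B"
    using B by (simp add: minus_mult_distrib_mat[of _ 2 2 _ _ 2] mult_smult_assoc_mat[of _ 2 2 _ 2])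
  \<comment> \<open>Replacing \<open>B * B\<close> gives \<open>B\<close> the coefficient a Q_(m+1)
    - b Q_m, which is Q_(m+2).\<close>
  also have "\<dots> = ?q (Suc (Suc m)) \<cdot>\<^sub>m B - (det B * ?q (Suc m)) \<cdot>\<^sub>m 1\<^sub>m 2"
    unfolding cayley_hamilton_2
    by (rule mat_2_eqI) (use B in \<open>auto simp: poly2_Qpoly algebra_simps\<close>)
  finally show ?case .
qed

text \<open>Cayley-Hamilton multiplied by \<open>B ^\<^sub>m m\<close>; taking traces then yields
  the recurrence of P_m.\<close>

lemma pow_mat_2_rec:
  "B ^\<^sub>m Suc (Suc m) = mat_trace B \<cdot>\<^sub>m B ^\<^sub>m Suc m - det B \<cdot>\<^sub>m B ^\<^sub>m m"
proof -
  have P: "B ^\<^sub>m m \<in> carrier_mat 2 2" using B by (rule pow_carrier_mat)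
  have "B ^\<^sub>m Suc (Suc m) = B ^\<^sub>m m * (B * B)"
    using B P by (simp add: assoc_mult_mat[of _ 2 2 _ 2])
  also have "\<dots> = mat_trace B \<cdot>\<^sub>m B ^\<^sub>m Suc m - det B \<cdot>\<^sub>m B ^\<^sub>m m"
    unfolding cayley_hamilton_2 using B P
    by (simp add: mult_minus_distrib_mat[of _ 2 2 _ 2] mult_smult_distrib[of _ 2 2 _ 2])
  finally show ?thesis .
qed

text \<open>Both sides obey the same two-step recurrence, and the start values agree: tr I = 1 + 1
  and tr B = a.\<close>

lemma mat_trace_pow_mat_2:
  "mat_trace (B ^\<^sub>m m) = poly2 (Ppoly m) (mat_trace B) (det B)"
proof (induction m rule: induct_nat_012)
  case 0
  show ?case using B by (simp add: mat_trace_2 poly2_Ppoly)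
next
  case 1
  show ?case using B by (simp add: poly2_Ppoly)
next
  case (ge2 m)
  have P: "B ^\<^sub>m k \<in> carrier_mat 2 2" for k using B by (rule pow_carrier_mat)
  have "mat_trace (B ^\<^sub>m Suc (Suc m)) =
      mat_trace B * mat_trace (B ^\<^sub>m Suc m) - det B * mat_trace (B ^\<^sub>m m)"
    unfolding pow_mat_2_rec by (rule mat_trace_smult_minus_smult[OF P P])
  with ge2 show ?case by (simp only: poly2_Ppoly)
qed

end

theorem theorem5:
  fixes A :: "'p::prime_card mod_ring mat" and n :: nat
  assumes "n \<ge> 3"
    and "A \<in> carrier_mat 2 2"
    and "\<forall>c. A \<noteq> c \<cdot>\<^sub>m 1\<^sub>m 2"
  shows "{B \<in> carrier_mat 2 2. B ^\<^sub>m n = A} \<subseteq>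
    {B \<in> carrier_mat 2 2. \<exists>a b.
       b ^ n = det A \<and>
       poly2 (Ppoly n) a b = mat_trace A \<and>
       poly2 (Qpoly (n - 1)) a b \<noteq> 0 \<and>
       B = (1 / poly2 (Qpoly (n - 1)) a b) \<cdot>\<^sub>m
             (A + (b * poly2 (Qpoly (n - 2)) a b) \<cdot>\<^sub>m 1\<^sub>m 2)}"
proof clarify
  fix B assume B: "B \<in> carrier_mat 2 2" and A: "A = B ^\<^sub>m n"
  define a b where "a = mat_trace B" and "b = det B"
  define q r where "q = poly2 (Qpoly (n - 1)) a b" and "r = poly2 (Qpoly (n - 2)) a b"
  \<comment> \<open>Since n \<ge> 3, the differences n - 1 and n - 2 are exact and become
    \<open>Suc m\<close> and \<open>m\<close>.\<close>
  obtain m where n: "n = Suc (Suc m)"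
    using assms(1) that[of "n - 2"] by simp
  have A_eq: "A = q \<cdot>\<^sub>m B - (b * r) \<cdot>\<^sub>m 1\<^sub>m 2"
    unfolding A q_def r_def a_def b_def n by (simp add: pow_mat_2_Qpoly[OF B] del: pow_mat.simps)
  have q: "q \<noteq> 0"
  proof
    assume "q = 0"
    then have "A = (- (b * r)) \<cdot>\<^sub>m 1\<^sub>m 2"
      unfolding A_eq by (intro mat_2_eqI) (use B in auto)
    with assms(3) show False by blast
  qed
  \<comment> \<open>Adding b r I to \<open>A_eq\<close> leaves q B, and q is invertible in the
    field.\<close>
  have "B = (1 / q) \<cdot>\<^sub>m (A + (b * r) \<cdot>\<^sub>m 1\<^sub>m 2)"
    unfolding A_eq by (rule mat_2_eqI) (use B q in auto)
  moreover have "b ^ n = det A" "poly2 (Ppoly n) a b = mat_trace A"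
    by (simp_all add: A a_def b_def det_pow_mat[OF B] mat_trace_pow_mat_2[OF B])
  ultimately show "\<exists>a b.
       b ^ n = det (B ^\<^sub>m n) \<and>
       poly2 (Ppoly n) a b = mat_trace (B ^\<^sub>m n) \<and>
       poly2 (Qpoly (n - 1)) a b \<noteq> 0 \<and>
       B = (1 / poly2 (Qpoly (n - 1)) a b) \<cdot>\<^sub>m
             (B ^\<^sub>m n + (b * poly2 (Qpoly (n - 2)) a b) \<cdot>\<^sub>m 1\<^sub>m 2)"
    using q unfolding q_def r_def A by blast
qed

end
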